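(* Let $n\ge 2$ be an integer and let $L_p$ be the Laguerre iteration function of the polynomial $p_n(z)=z^n-1$. Then $L_p$ commutes with the inversion $z\mapsto 1/\bar z$ with respect to the unit circle $S^1=\{z\in\mathbb{C}: |z|=1\}$; that is, $L_p(1/\bar z)=1/\overline{L_p(z)}$ for every $z$ in the domain of $L_p$.
   Context: $\sqrt{w}$ denotes the principal square root: if $w=\rho e^{i\phi}$ with $\rho>0$ and $-\pi<\phi\le\pi$, then $\sqrt{w}=\sqrt{\rho}\,e^{i\phi/2}$. For an integer $n\ge2$, the Laguerre iteration function of $p_n(z)=z^n-1$ is $$L_p(z)=z\,\frac{\frac{1}{\sqrt{z^n}}+(n-1)}{\sqrt{z^n}+(n-1)},\qquad z\in\mathbb{C}\setminus\{0\}.$$ For $n\ge3$ it is extended to the extended complex plane $\hat{\mathbb{C}}=\mathbb{C}\cup\{\infty\}$ by $L_p(0)=\infty$ and $L_p(\infty)=0$; the inversion $z\mapsto1/\bar z$ exchanges $0$ and $\infty$. Thus the domain of $L_p$ is $\hat{\mathbb{C}}$ for $n\ge 3$ and $\mathbb{C}\setminus\{0\}$ for $n=2$. One has $L_p(z)\neq0$ for $z\in\mathbb{C}\setminus\{0\}$. *)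

theory Defs
  imports Complex_Main "HOL-Library.FuncSet"
begin

text \<open>
  The extended complex plane is the type \<^typ>\<open>complex option\<close>, with \<^term>\<open>None\<close> as the
  point at infinity (the convention of \<open>Alexandroff_extension\<close> in \<open>HOL-Analysis\<close>).
\<close>

type_synonym ecomplex = "complex option"

fun inversion :: "ecomplex \<Rightarrow> ecomplex" where
  "inversion None = Some 0"
| "inversion (Some z) = (if z = 0 then None else Some (1 / cnj z))"

text \<open>
  The library function \<^const>\<open>csqrt\<close> is the principal square root: for a nonzero number its value has argument in
  the half-open interval from \<open>-pi/2\<close> (excluded) to \<open>pi/2\<close> (included), so a negative
  real has its root on the positive imaginary axis.
\<close>

definition laguerre_fin :: "nat \<Rightarrow> complex \<Rightarrow> complex" where
  "laguerre_fin n z =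
     z * ((1 / csqrt (z ^ n) + (of_nat n - 1)) / (csqrt (z ^ n) + (of_nat n - 1)))"

definition laguerre_domain :: "nat \<Rightarrow> ecomplex set" where
  "laguerre_domain n = (if n \<ge> 3 then UNIV else {Some z | z. z \<noteq> 0})"

text \<open>
  By \<^const>\<open>restrict\<close>, the map takes the unspecified value \<^term>\<open>undefined\<close> outside its
  domain; for \<open>n \<ge> 2\<close> this occurs only at \<open>0\<close> and at infinity when \<open>n = 2\<close>.
\<close>

definition laguerre :: "nat \<Rightarrow> ecomplex \<Rightarrow> ecomplex" where
  "laguerre n =
     (\<lambda>z \<in> laguerre_domain n.
        case z of
          None \<Rightarrow> Some 0
        | Some w \<Rightarrow> (if w = 0 then None else Some (laguerre_fin n w)))"

end

theory Submission
  imports Defs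
begin

text \<open>
  Inversion in the unit circle preserves arguments, since \<open>1 / cnj w = w / |w|\<^sup>2\<close>. The principal
  root is chosen by the argument of \<open>w\<close>, so it commutes with the inversion, including on the branch
  cut (\<open>csqrt_inverse_cnj\<close>). The powers \<open>z ^ n\<close> commute with the inversion as well. Hence passing
  from \<open>z\<close> to \<open>1 / cnj z\<close> replaces \<open>s = csqrt (z ^ n)\<close> by \<open>1 / cnj s\<close>, which conjugates the
  numerator and the denominator of the Laguerre quotient and interchanges them. As the coefficient
  \<open>n - 1\<close> is real, the result is the inverse of the conjugate.

  On the extended plane one must also know that a finite nonzero point is not mapped to \<open>0\<close>, whose
  inverse point is infinity. This is \<open>laguerre_fin_nonzero\<close>, and it holds because principal roots
  lie in the closed right half-plane.
\<close>

text \<open>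
  For \<open>w \<noteq> 0\<close> the candidate root \<open>1 / cnj s\<close> is a positive multiple of \<open>s = csqrt w\<close>, and the set of
  principal roots is closed under positive scaling. For \<open>w = 0\<close> both sides are \<open>0\<close> by the convention
  \<open>1 / 0 = 0\<close>.
\<close>

lemma csqrt_inverse_cnj: "csqrt (1 / cnj w) = 1 / cnj (csqrt w)"
proof (rule csqrt_unique)
  show "(1 / cnj (csqrt w))\<^sup>2 = 1 / cnj w"
    by (simp add: power_divide flip: complex_cnj_power)
  have Re: "Re (1 / cnj s) = Re s / (cmod s)\<^sup>2"
    and Im: "Im (1 / cnj s) = Im s / (cmod s)\<^sup>2" for s
    by (simp_all add: Re_divide Im_divide cmod_power2)
  show "0 < Re (1 / cnj (csqrt w)) \<or> Re (1 / cnj (csqrt w)) = 0 \<and> 0 \<le> Im (1 / cnj (csqrt w))"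
  proof (cases "w = 0")
    case False
    then have "0 < (cmod (csqrt w))\<^sup>2"
      by simp
    then show ?thesis
      unfolding Re Im using csqrt_principal[of w] by (auto intro: divide_pos_pos)
  qed simp
qed

lemma laguerre_fin_inverse_cnj: "laguerre_fin n (1 / cnj z) = 1 / cnj (laguerre_fin n z)"
proof -
  have "csqrt ((1 / cnj z) ^ n) = 1 / cnj (csqrt (z ^ n))"
    using csqrt_inverse_cnj[of "z ^ n"] by (simp add: power_divide)
  then show ?thesis
    by (simp add: laguerre_fin_def)
qed

text \<open>
  Both the root and its reciprocal have nonnegative real part, so adding \<open>n - 1 > 0\<close> moves numerator
  and denominator into the open right half-plane.
\<close>

lemma laguerre_fin_nonzero:
  assumes "n \<ge> 2" and "z \<noteq> 0"
  shows "laguerre_fin n z \<noteq> 0"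
proof -
  define s where "s = csqrt (z ^ n)"
  have "Re s \<ge> 0"
    unfolding s_def using csqrt_principal[of "z ^ n"] by auto
  then have "Re (s + (of_nat n - 1)) > 0" and "Re (1 / s + (of_nat n - 1)) > 0"
    using assms(1) by (auto simp: Re_divide intro: add_nonneg_pos)
  then have "s + (of_nat n - 1) \<noteq> 0" and "1 / s + (of_nat n - 1) \<noteq> 0"
    by (metis less_irrefl zero_complex.sel(1))+
  with assms(2) show ?thesis
    by (simp add: laguerre_fin_def flip: s_def)
qed

lemma inversion_in_laguerre_domain:
  assumes "z \<in> laguerre_domain n"
  shows "inversion z \<in> laguerre_domain n"
  using assms by (auto simp: laguerre_domain_def split: if_splits)

theorem proposition3p3:
  fixes n :: nat and z :: ecomplex
  assumes "n \<ge> 2" and "z \<in> laguerre_domain n"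
  shows "laguerre n (inversion z) = inversion (laguerre n z)"
proof (cases z)
  case None
  with assms inversion_in_laguerre_domain[OF assms(2)] show ?thesis
    by (simp add: laguerre_def)
next
  case (Some w)
  with assms inversion_in_laguerre_domain[OF assms(2)] show ?thesis
    by (auto simp: laguerre_def laguerre_fin_nonzero laguerre_fin_inverse_cnj)
qed

end
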